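(* Let $S$ be a finite left regular band with identity, let $L$ be its support lattice, and let $k$ be a field. Then the (Ext-)quiver of the semigroup algebra $kS$ has vertex set $L$ and, for $X,Y\in L$, exactly $a_{XY}$ arrows from the vertex $X$ to the vertex $Y$.
   Context: A left regular band is a semigroup $S$ with $x^2=x$ and $xyx=xy$ for all $x,y\in S$. Partially order $S$ by $y\le x$ iff $yx=x$ (write $y<x$ if $y\le x$, $y\ne x$). Define the preorder $y\preceq x$ iff $xy=x$; identifying $x,y$ when $x\preceq y$ and $y\preceq x$ gives a poset $L$ (the support lattice; for $S$ finite with identity it is a finite lattice) with quotient map $\operatorname{supp}:S\to L$, satisfying $\operatorname{supp}(xy)=\operatorname{supp}(x)\vee\operatorname{supp}(y)$ and $xy=x$ iff $\operatorname{supp}(y)\le\operatorname{supp}(x)$. For $X\in L$ let $S_X=\{x\in S:\operatorname{supp}(x)=X\}$. The simple $kS$-modules are the one-dimensional modules $M_X=k$, $X\in L$, on which $s\in S$ acts by the scalar $\chi_X(s)$, where $\chi_X(s)=1$ if $\operatorname{supp}(s)\le X$ and $0$ otherwise. The quiver of a finite-dimensional algebra $A$ all of whose simple modules are one-dimensional has one vertex per isomorphism class of simple modules and $\dim_k\operatorname{Ext}^1_A(M_X,M_Y)$ arrows from $X$ to $Y$. Definition of $a_{XY}$: if $Y\not< X$ in $L$, put $a_{XY}=0$. If $Y<X$, fix $y\in S$ with $\operatorname{supp}(y)=Y$ and define a relation on $S_X$ by $x\smile x'$ iff there exists $w\in S$ with $y<w$, $w<yx$ and $w<yx'$; let $\sim$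 be the equivalence relation on $S_X$ generated by $\smile$, and put $a_{XY}=\#(S_X/\sim)-1$ (this does not depend on the choice of $y$).
   Formalization: In the definition of x ⌣ x', the conditions w<yx and w<yx' are replaced by w≤yx and w≤yx' (y<w stays strict); with strict inequalities the claim fails, e.g. for the free left regular band with identity on two generators a, b with y=a and X=supp(ab). *)

theory Defs
  imports Main "HOL-Library.Poly_Mapping"
begin

section \<open>Left regular bands and their support lattice\<close>

class left_regular_band = semigroup_mult +
  assumes idem: "x * x = x"
    and left_regular: "x * y * x = x * y"

class left_regular_band_1 = left_regular_band + monoid_mult

definition lrb_le :: "'s::left_regular_band \<Rightarrow> 's \<Rightarrow> bool"
  where "lrb_le y x \<longleftrightarrow> y * x = x"

definition lrb_less :: "'s::left_regular_band \<Rightarrow> 's \<Rightarrow> bool"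
  where "lrb_less y x \<longleftrightarrow> lrb_le y x \<and> y \<noteq> x"

definition lrb_preceq :: "'s::left_regular_band \<Rightarrow> 's \<Rightarrow> bool"
  where "lrb_preceq y x \<longleftrightarrow> x * y = x"

lemma lrb_preceq_refl: "lrb_preceq x x"
  by (simp add: lrb_preceq_def idem)

lemma lrb_preceq_trans: "lrb_preceq x y \<Longrightarrow> lrb_preceq y z \<Longrightarrow> lrb_preceq x z"
  unfolding lrb_preceq_def by (metis mult.assoc)

definition supp_equiv :: "'s::left_regular_band \<Rightarrow> 's \<Rightarrow> bool"
  where "supp_equiv x y \<longleftrightarrow> lrb_preceq x y \<and> lrb_preceq y x"

lemma equivp_supp_equiv: "equivp supp_equiv"
  by (rule equivpI)
    (auto simp: reflp_def symp_def transp_def supp_equiv_def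
      intro: lrb_preceq_refl lrb_preceq_trans)

quotient_type (overloaded) 's support = "'s::left_regular_band" / supp_equiv
  morphisms rep_support supp
  by (rule equivp_supp_equiv)

instantiation support :: (left_regular_band) order
begin

lift_definition less_eq_support :: "'a support \<Rightarrow> 'a support \<Rightarrow> bool" is lrb_preceq
  unfolding supp_equiv_def by (blast intro: lrb_preceq_trans)

definition less_support :: "'a support \<Rightarrow> 'a support \<Rightarrow> bool"
  where "less_support X Y \<longleftrightarrow> X \<le> Y \<and> \<not> Y \<le> X"

instance
proof
  fix X Y Z :: "'a support"
  show "X < Y \<longleftrightarrow> X \<le> Y \<and> \<not> Y \<le> X" by (rule less_support_def)
  show "X \<le> X" by transfer (rule lrb_preceq_refl)
  show "X \<le> Y \<Longrightarrow> Y \<le> Z \<Longrightarrow> X \<le> Z" by transfer (rule lrb_preceq_trans)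
  show "X \<le> Y \<Longrightarrow> Y \<le> X \<Longrightarrow> X = Y" by transfer (simp add: supp_equiv_def)
qed

end

lemma supp_le_iff: "supp y \<le> supp x \<longleftrightarrow> x * y = x"
  by transfer (simp add: lrb_preceq_def)

section \<open>The numbers \<open>a\<^sub>X\<^sub>Y\<close>\<close>

definition supp_fiber :: "'s::left_regular_band support \<Rightarrow> 's set"
  where "supp_fiber X = {x. supp x = X}"

text \<open>
  The element \<open>w\<close> is allowed to be equal to \<open>y x\<close> or \<open>y x'\<close>, which makes the relation reflexive
  on the fibre over \<open>X\<close> whenever \<open>supp y < X\<close>. This differs from requiring \<open>w < y x\<close> and
  \<open>w < y x'\<close> strictly only for pairs with \<open>y x = y x'\<close> where nothing lies strictly between \<open>y\<close>
  and \<open>y x\<close>, and there the strict version miscounts: in the free left regular band with identity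
  on \<open>a, b\<close>, with \<open>y = a\<close> and \<open>X = supp (a b)\<close>, one has \<open>y (a b) = y (b a) = a b\<close>, so the strict
  relation is empty and yields one arrow from \<open>X\<close> to \<open>supp a\<close>, although the Ext group is zero.
\<close>
definition smile :: "'s::left_regular_band \<Rightarrow> 's support \<Rightarrow> 's \<Rightarrow> 's \<Rightarrow> bool"
  where "smile y X x x' \<longleftrightarrow> x \<in> supp_fiber X \<and> x' \<in> supp_fiber X \<and>
    (\<exists>w. lrb_less y w \<and> lrb_le w (y * x) \<and> lrb_le w (y * x'))"

text \<open>\<open>arrow_number y X Y\<close> is \<open>a\<^sub>X\<^sub>Y\<close> computed with the representative \<open>y\<close> of \<open>Y\<close>.\<close>
definition arrow_number ::
    "'s::left_regular_band \<Rightarrow> 's support \<Rightarrow> 's support \<Rightarrow> nat"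
  where "arrow_number y X Y =
    (if Y < X then card (supp_fiber X // {(x, x'). equivclp (smile y X) x x'}) - 1 else 0)"

section \<open>Left modules over a ring with unit\<close>

locale left_module =
  fixes scale :: "'a::ring_1 \<Rightarrow> 'm::ab_group_add \<Rightarrow> 'm"
  assumes scale_right_distrib: "scale a (x + y) = scale a x + scale a y"
    and scale_left_distrib: "scale (a + b) x = scale a x + scale b x"
    and scale_scale: "scale a (scale b x) = scale (a * b) x"
    and scale_one: "scale 1 x = x"

definition submodule :: "('a::ring_1 \<Rightarrow> 'm::ab_group_add \<Rightarrow> 'm) \<Rightarrow> 'm set \<Rightarrow> bool"
  where "submodule scale W \<longleftrightarrow>
    0 \<in> W \<and> (\<forall>x\<in>W. \<forall>y\<in>W. x + y \<in> W) \<and> (\<forall>a. \<forall>x\<in>W. scale a x \<in> W)"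

definition simple_module :: "('a::ring_1 \<Rightarrow> 'm::ab_group_add \<Rightarrow> 'm) \<Rightarrow> bool"
  where "simple_module scale \<longleftrightarrow> left_module scale \<and> (UNIV :: 'm set) \<noteq> {0} \<and>
    (\<forall>W. submodule scale W \<longrightarrow> W = {0} \<or> W = UNIV)"

text \<open>
  Homomorphisms defined on a submodule \<open>C\<close>. They are extended by \<open>0\<close> outside \<open>C\<close>, so that equal
  homomorphisms on \<open>C\<close> are equal as functions.
\<close>
definition module_homs :: "'m set \<Rightarrow> ('a::ring_1 \<Rightarrow> 'm::ab_group_add \<Rightarrow> 'm) \<Rightarrow>
    ('a \<Rightarrow> 'n::ab_group_add \<Rightarrow> 'n) \<Rightarrow> ('m \<Rightarrow> 'n) set"
  where "module_homs C s1 s2 = {f.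
    (\<forall>x\<in>C. \<forall>y\<in>C. f (x + y) = f x + f y) \<and>
    (\<forall>a. \<forall>x\<in>C. f (s1 a x) = s2 a (f x)) \<and>
    (\<forall>x. x \<notin> C \<longrightarrow> f x = 0)}"

definition module_isomorphic :: "('a::ring_1 \<Rightarrow> 'm::ab_group_add \<Rightarrow> 'm) \<Rightarrow>
    ('a \<Rightarrow> 'n::ab_group_add \<Rightarrow> 'n) \<Rightarrow> bool"
  where "module_isomorphic s1 s2 \<longleftrightarrow> (\<exists>f\<in>module_homs UNIV s1 s2. bij f)"

section \<open>The canonical free resolution and the first Ext group\<close>

definition free_module :: "'m set \<Rightarrow> ('m \<Rightarrow>\<^sub>0 'a::zero) set"
  where "free_module C = {p. Poly_Mapping.keys p \<subseteq> C}"

definition free_scale :: "'a::ring_1 \<Rightarrow> ('m \<Rightarrow>\<^sub>0 'a) \<Rightarrow> ('m \<Rightarrow>\<^sub>0 'a)"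
  where "free_scale a p = Poly_Mapping.map (\<lambda>b. a * b) p"

text \<open>The linear map from the free module on a module to that module which fixes generators.\<close>
definition free_eval :: "('a::ring_1 \<Rightarrow> 'm::ab_group_add \<Rightarrow> 'm) \<Rightarrow> ('m \<Rightarrow>\<^sub>0 'a) \<Rightarrow> 'm"
  where "free_eval scale p =
    (\<Sum>x\<in>Poly_Mapping.keys p. scale (Poly_Mapping.lookup p x) x)"

definition syzygies :: "'m set \<Rightarrow> ('a::ring_1 \<Rightarrow> 'm::ab_group_add \<Rightarrow> 'm) \<Rightarrow> ('m \<Rightarrow>\<^sub>0 'a) set"
  where "syzygies C scale = {p \<in> free_module C. free_eval scale p = 0}"

text \<open>
  The beginning \<open>P\<^sub>2 \<rightarrow> P\<^sub>1 \<rightarrow> P\<^sub>0 \<rightarrow> M \<rightarrow> 0\<close> of the canonical free resolution of \<open>M\<close>: \<open>P\<^sub>0\<close> is the free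
  module on \<open>M\<close>, \<open>P\<^sub>1\<close> the free module on the kernel of \<open>P\<^sub>0 \<rightarrow> M\<close>, and \<open>P\<^sub>2\<close> the free module on the
  kernel of \<open>P\<^sub>1 \<rightarrow> P\<^sub>0\<close>. All maps are instances of \<open>free_eval\<close>.
\<close>
definition res0 :: "('a::ring_1 \<Rightarrow> 'm::ab_group_add \<Rightarrow> 'm) \<Rightarrow> ('m \<Rightarrow>\<^sub>0 'a) set"
  where "res0 sM = free_module UNIV"

definition res1 :: "('a::ring_1 \<Rightarrow> 'm::ab_group_add \<Rightarrow> 'm) \<Rightarrow> (('m \<Rightarrow>\<^sub>0 'a) \<Rightarrow>\<^sub>0 'a) set"
  where "res1 sM = free_module (syzygies UNIV sM)"

definition res2 :: "('a::ring_1 \<Rightarrow> 'm::ab_group_add \<Rightarrow> 'm) \<Rightarrow>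
    ((('m \<Rightarrow>\<^sub>0 'a) \<Rightarrow>\<^sub>0 'a) \<Rightarrow>\<^sub>0 'a) set"
  where "res2 sM = free_module (syzygies (syzygies UNIV sM) free_scale)"

text \<open>
  \<open>Ext\<^sup>1(M, N)\<close> is the cohomology \<open>ext1_cocycles / ext1_coboundaries\<close> of
  \<open>Hom(P\<^sub>0, N) \<rightarrow> Hom(P\<^sub>1, N) \<rightarrow> Hom(P\<^sub>2, N)\<close> in the middle term.
\<close>
definition ext1_cocycles :: "('a::ring_1 \<Rightarrow> 'm::ab_group_add \<Rightarrow> 'm) \<Rightarrow>
    ('a \<Rightarrow> 'n::ab_group_add \<Rightarrow> 'n) \<Rightarrow> ((('m \<Rightarrow>\<^sub>0 'a) \<Rightarrow>\<^sub>0 'a) \<Rightarrow> 'n) set"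
  where "ext1_cocycles sM sN =
    {f \<in> module_homs (res1 sM) free_scale sN. \<forall>r\<in>res2 sM. f (free_eval free_scale r) = 0}"

definition ext1_coboundaries :: "('a::ring_1 \<Rightarrow> 'm::ab_group_add \<Rightarrow> 'm) \<Rightarrow>
    ('a \<Rightarrow> 'n::ab_group_add \<Rightarrow> 'n) \<Rightarrow> ((('m \<Rightarrow>\<^sub>0 'a) \<Rightarrow>\<^sub>0 'a) \<Rightarrow> 'n) set"
  where "ext1_coboundaries sM sN =
    (\<lambda>g q. if q \<in> res1 sM then g (free_eval free_scale q) else 0) `
      module_homs (res0 sM) free_scale sN"

text \<open>
  For spaces \<open>B \<subseteq> Z\<close> of functions into a \<open>k\<close>-vector space with pointwise operations: the quotient
  \<open>Z / B\<close> has a basis of \<open>n\<close> elements, namely the classes of the elements of \<open>T\<close>.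
\<close>
definition quotient_has_dim :: "('k::field \<Rightarrow> 'n::ab_group_add \<Rightarrow> 'n) \<Rightarrow>
    ('q \<Rightarrow> 'n) set \<Rightarrow> ('q \<Rightarrow> 'n) set \<Rightarrow> nat \<Rightarrow> bool"
  where "quotient_has_dim scale Z B n \<longleftrightarrow> (\<exists>T. T \<subseteq> Z \<and> finite T \<and> card T = n \<and>
    (\<forall>z\<in>Z. \<exists>c. (\<lambda>q. z q - (\<Sum>t\<in>T. scale (c t) (t q))) \<in> B) \<and>
    (\<forall>c. (\<lambda>q. \<Sum>t\<in>T. scale (c t) (t q)) \<in> B \<longrightarrow> (\<forall>t\<in>T. c t = 0)))"

text \<open>
  \<open>A\<close> is a \<open>k\<close>-algebra with structure map \<open>\<iota> : k \<rightarrow> A\<close>, through which \<open>N\<close>, and hence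
  \<open>Ext\<^sup>1(M, N)\<close>, is a \<open>k\<close>-vector space.
\<close>
definition ext1_has_dim :: "('k::field \<Rightarrow> 'a::ring_1) \<Rightarrow>
    ('a \<Rightarrow> 'm::ab_group_add \<Rightarrow> 'm) \<Rightarrow> ('a \<Rightarrow> 'n::ab_group_add \<Rightarrow> 'n) \<Rightarrow> nat \<Rightarrow> bool"
  where "ext1_has_dim \<iota> sM sN n \<longleftrightarrow>
    quotient_has_dim (\<lambda>c. sN (\<iota> c)) (ext1_cocycles sM sN) (ext1_coboundaries sM sN) n"

section \<open>The semigroup algebra and its one-dimensional modules\<close>

text \<open>
  The convolution product on finitely supported functions in the library is the one of the monoid
  algebra of an additively written, not necessarily commutative, monoid. The following copy of a
  multiplicative monoid is written additively.
\<close>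
datatype 's additive = Additive (of_additive: 's)

instantiation additive :: (monoid_mult) monoid_add
begin

definition zero_additive :: "'a additive"
  where "0 = Additive 1"

definition plus_additive :: "'a additive \<Rightarrow> 'a additive \<Rightarrow> 'a additive"
  where "x + y = Additive (of_additive x * of_additive y)"

instance
  by standard (simp_all add: zero_additive_def plus_additive_def mult.assoc)

end

type_synonym ('s, 'k) semigroup_algebra = "'s additive \<Rightarrow>\<^sub>0 'k"

definition algebra_const :: "'k::field \<Rightarrow> ('s::monoid_mult, 'k) semigroup_algebra"
  where "algebra_const c = Poly_Mapping.single 0 c"

definition supp_char :: "'s::left_regular_band support \<Rightarrow> 's \<Rightarrow> 'k::field"
  where "supp_char X s = (if supp s \<le> X then 1 else 0)"

text \<open>The module \<open>M\<^sub>X\<close>: the linear extension of the action of \<open>s\<close> by \<open>supp_char X s\<close>.\<close>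
definition supp_module :: "'s::left_regular_band_1 support \<Rightarrow>
    ('s, 'k::field) semigroup_algebra \<Rightarrow> 'k \<Rightarrow> 'k"
  where "supp_module X a v =
    (\<Sum>s\<in>Poly_Mapping.keys a. Poly_Mapping.lookup a s * supp_char X (of_additive s)) * v"

end

theory Submission
  imports Defs
begin

text \<open>
  For characters \<open>\<phi>, \<psi>\<close> of a monoid, the extensions of the one-dimensional module \<open>k\<^sub>\<psi>\<close> by \<open>k\<^sub>\<phi>\<close>
  are classified by the derivations \<open>d (s t) = \<phi> s d t + d s \<psi> t\<close> modulo the inner ones
  \<open>c (\<phi> - \<psi>)\<close>. For the characters of \<open>Y\<close> and \<open>X\<close> of a left regular band, the identities
  \<open>s s = s\<close> and \<open>s t s = s t\<close> force every derivation to be inner unless \<open>Y < X\<close>. If \<open>Y < X\<close>, a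
  derivation vanishes off \<open>{s. supp s \<le> X, \<not> supp s \<le> Y}\<close> and satisfies \<open>d s = d (s x)\<close> there for
  \<open>x\<close> in the fibre over \<open>X\<close>, so it is determined by its restriction to that fibre; the functions
  arising in this way are exactly those constant on the classes of \<open>\<sim>\<close>, and the inner derivations
  correspond to the constant functions.

  On a simple module, choose \<open>s\<close> of maximal support \<open>X\<close> among the elements acting nontrivially. The
  vectors killed by all \<open>t\<close> with \<open>\<not> supp t \<le> X\<close>, and the kernel of \<open>s\<close>, are submodules; this forces
  every \<open>t\<close> to act by the scalar \<open>\<chi>\<^sub>X t\<close>.
\<close>

section \<open>Cocycles and syzygies\<close>

text \<open>Reduces additive statements to generators: inserting a value at a fresh key amounts to
  adding a \<open>single\<close>.\<close>

lemma poly_mapping_single_add_induct [case_names zero single add]: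
  fixes p :: "'a \<Rightarrow>\<^sub>0 'b::monoid_add"
  assumes "P 0" "\<And>x b. P (Poly_Mapping.single x b)" "\<And>p q. P p \<Longrightarrow> P q \<Longrightarrow> P (p + q)"
  shows "P p"
proof (induction p rule: Poly_Mapping.update_induct)
  case const
  show ?case by (rule assms(1))
next
  case (update f a b)
  have "Poly_Mapping.update a b f = Poly_Mapping.single a b + f"
    using update.hyps(1)
    by (intro poly_mapping_eqI)
      (auto simp: lookup_add lookup_update lookup_single in_keys_iff when_def)
  then show ?case
    using assms(2,3) update.IH by simp
qed

section \<open>Free modules and their evaluation maps\<close>

lemma lookup_free_scale: "Poly_Mapping.lookup (free_scale a p) x = a * Poly_Mapping.lookup p x"
  by (simp add: free_scale_def Poly_Mapping.map.rep_eq when_def)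

lemma keys_free_scale: "Poly_Mapping.keys (free_scale a p) \<subseteq> Poly_Mapping.keys p"
  by (auto simp: in_keys_iff lookup_free_scale)

lemma free_scale_single [simp]:
  "free_scale a (Poly_Mapping.single x b) = Poly_Mapping.single x (a * b)"
  by (rule poly_mapping_eqI) (simp add: lookup_free_scale lookup_single when_def)

lemma free_scale_0 [simp]: "free_scale a 0 = 0"
  by (rule poly_mapping_eqI) (simp add: lookup_free_scale)

lemma free_scale_diff: "free_scale a (p - q) = free_scale a p - free_scale a q"
  by (rule poly_mapping_eqI) (simp add: lookup_free_scale lookup_minus right_diff_distrib)

interpretation free_scale: left_module "free_scale :: 'a::ring_1 \<Rightarrow> ('m \<Rightarrow>\<^sub>0 'a) \<Rightarrow> _"
  by standard
    (auto intro!: poly_mapping_eqI simp: lookup_free_scale lookup_add algebra_simps)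

text \<open>Assumes only additivity in the scalar, so that it also covers maps that are not module
  actions, such as \<open>char_module d\<close> for a derivation \<open>d\<close>.\<close>

lemma free_eval_add:
  assumes "\<And>a b x. scale (a + b) x = scale a x + scale b x"
  shows "free_eval scale (p + q) = free_eval scale p + free_eval scale q"
proof -
  have zero: "scale 0 x = 0" for x
    using assms[of 0 0 x] by simp
  show ?thesis
    unfolding free_eval_def by (rule setsum_keys_plus_distrib) (auto simp: zero assms)
qed

lemma free_eval_0 [simp]: "free_eval scale 0 = 0"
  by (simp add: free_eval_def)

lemma free_eval_single:
  assumes "scale 0 x = 0"
  shows "free_eval scale (Poly_Mapping.single x a) = scale a x"
  using assms by (simp add: free_eval_def)

context left_module
begin

lemma scale_zero_left [simp]: "scale 0 x = 0"
  using scale_left_distrib[of 0 0 x] by simp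

lemma scale_zero_right [simp]: "scale a 0 = 0"
  using scale_right_distrib[of a 0 0] by simp

lemma scale_minus_left: "scale (- a) x = - scale a x"
  using scale_left_distrib[of "- a" a x] by (simp add: eq_neg_iff_add_eq_0)

lemma eval_add: "free_eval scale (p + q) = free_eval scale p + free_eval scale q"
  by (rule free_eval_add) (rule scale_left_distrib)

lemma eval_single [simp]: "free_eval scale (Poly_Mapping.single x a) = scale a x"
  by (rule free_eval_single) simp

lemma eval_scale: "free_eval scale (free_scale a p) = scale a (free_eval scale p)"
  by (induction p rule: poly_mapping_single_add_induct)
    (simp_all add: eval_add scale_right_distrib free_scale.scale_right_distrib scale_scale)

lemma eval_uminus: "free_eval scale (- p) = - free_eval scale p"
  using eval_add[of "- p" p] by (simp add: eq_neg_iff_add_eq_0)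

lemma eval_diff: "free_eval scale (p - q) = free_eval scale p - free_eval scale q"
  using eval_add[of p "- q"] by (simp add: eval_uminus)

lemma free_eval_in_submodule:
  assumes "submodule scale W" "p \<in> free_module W"
  shows "free_eval scale p \<in> W"
proof -
  have "(\<Sum>x\<in>K. scale (Poly_Mapping.lookup p x) x) \<in> W" if "finite K" "K \<subseteq> W" for K
    using that assms(1) by (induction K rule: finite_induct) (auto simp: submodule_def)
  then show ?thesis
    using assms(2) by (simp add: free_eval_def free_module_def)
qed

end

section \<open>Submodules and homomorphisms on them\<close>

lemma submodule_free_module: "submodule free_scale (free_module C)"
  by (auto simp: submodule_def free_module_def
      dest: subsetD[OF keys_add] subsetD[OF keys_free_scale])

lemma submodule_syzygies:
  assumes "left_module scale"
  shows "submodule free_scale (syzygies C scale)"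
proof -
  interpret left_module scale by fact
  show ?thesis
    using submodule_free_module[of C]
    by (auto simp: submodule_def syzygies_def eval_add eval_scale)
qed

lemma submodule_add: "\<lbrakk>submodule scale W; x \<in> W; y \<in> W\<rbrakk> \<Longrightarrow> x + y \<in> W"
  by (simp add: submodule_def)

lemma submodule_scale: "\<lbrakk>submodule scale W; x \<in> W\<rbrakk> \<Longrightarrow> scale a x \<in> W"
  by (simp add: submodule_def)

lemma module_homs_add:
  "\<lbrakk>f \<in> module_homs C s1 s2; x \<in> C; y \<in> C\<rbrakk> \<Longrightarrow> f (x + y) = f x + f y"
  by (simp add: module_homs_def)

lemma module_homs_scale: "\<lbrakk>f \<in> module_homs C s1 s2; x \<in> C\<rbrakk> \<Longrightarrow> f (s1 a x) = s2 a (f x)"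
  by (simp add: module_homs_def)

lemma submodule_diff:
  assumes "left_module scale" "submodule scale W" "x \<in> W" "y \<in> W"
  shows "x - y \<in> W"
proof -
  interpret left_module scale by fact
  have "scale (- 1) y \<in> W"
    using assms by (auto simp: submodule_def)
  then have "- y \<in> W"
    by (simp add: scale_minus_left scale_one)
  with assms(2,3) have "x + - y \<in> W"
    by (rule submodule_add)
  then show ?thesis by simp
qed

lemma module_homs_diff:
  assumes "left_module s1" "submodule s1 C" "f \<in> module_homs C s1 s2" "x \<in> C" "y \<in> C"
  shows "f (x - y) = f x - f y"
proof -
  have "f (x - y + y) = f (x - y) + f y"
    by (intro module_homs_add[OF assms(3)] submodule_diff[OF assms(1,2,4,5)] assms(5))
  then show ?thesis by (simp add: eq_diff_eq)
qed

text \<open>Exactness at \<open>P1\<close>: a cocycle kills the kernel of the evaluation from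
  \<open>P1\<close> onto the syzygies of \<open>M\<close>, so it descends to a homomorphism on these
  syzygies.\<close>

lemma ext1_cocycle_factors:
  fixes sM :: "'a::ring_1 \<Rightarrow> 'm::ab_group_add \<Rightarrow> 'm"
  assumes "left_module sM" "f \<in> ext1_cocycles sM sN"
  obtains h where "h \<in> module_homs (syzygies UNIV sM) free_scale sN"
    and "\<And>q. q \<in> res1 sM \<Longrightarrow> f q = h (free_eval free_scale q)"
proof -
  let ?K = "syzygies UNIV sM"
  let ?e = "\<lambda>p. Poly_Mapping.single p (1 :: 'a)"
  note K = submodule_syzygies[OF assms(1), of UNIV]
  note P = submodule_free_module[of ?K]
  have f: "f \<in> module_homs (free_module ?K) free_scale sN"
    using assms(2) by (simp add: ext1_cocycles_def res1_def)
  \<comment> \<open>An element of this kernel is itself a generator of \<open>P2\<close>, hence the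
    image of a basis element there.\<close>
  have vanish: "f q = 0" if "q \<in> free_module ?K" "free_eval free_scale q = 0" for q
  proof -
    have "?e q \<in> res2 sM"
      using that by (simp add: res2_def free_module_def syzygies_def)
    then have "f (free_eval free_scale (?e q)) = 0"
      using assms(2) by (simp only: ext1_cocycles_def mem_Collect_eq)
    then show ?thesis
      by (simp add: free_scale.scale_one)
  qed
  have eq: "f q = f q'" if "q \<in> free_module ?K" "q' \<in> free_module ?K"
    "free_eval free_scale q = free_eval free_scale q'" for q q'
  proof -
    have "f (q - q') = 0"
      using that by (intro vanish submodule_diff[OF free_scale.left_module_axioms P])
        (simp_all add: free_scale.eval_diff)
    then show ?thesis
      using module_homs_diff[OF free_scale.left_module_axioms P f that(1,2)] by simp
  qed
  have e: "?e p \<in> free_module ?K" if "p \<in> ?K" for p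
    using that by (simp add: free_module_def)
  \<comment> \<open>Each syzygy is lifted to its own generator. The lift is not additive, but the
    two sides of each law have the same image under evaluation, so \<open>eq\<close>
    applies.\<close>
  define h where "h p = (if p \<in> ?K then f (?e p) else 0)" for p
  have "h (p + q) = h p + h q" if "p \<in> ?K" "q \<in> ?K" for p q
  proof -
    have pq: "p + q \<in> ?K"
      using that by (rule submodule_add[OF K])
    moreover have "?e p + ?e q \<in> free_module ?K"
      using that by (intro submodule_add[OF P] e)
    ultimately have "f (?e (p + q)) = f (?e p + ?e q)"
      by (intro eq e) (simp_all only: free_scale.eval_single free_scale.eval_add free_scale.scale_one)
    moreover have "f (?e p + ?e q) = f (?e p) + f (?e q)"
      using that by (intro module_homs_add[OF f] e)
    ultimately show ?thesis
      using that pq by (simp only: h_def if_True)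
  qed
  moreover have "h (free_scale a p) = sN a (h p)" if "p \<in> ?K" for a p
  proof -
    have ap: "free_scale a p \<in> ?K"
      using that by (rule submodule_scale[OF K])
    moreover have "free_scale a (?e p) \<in> free_module ?K"
      using that by (intro submodule_scale[OF P] e)
    ultimately have "f (?e (free_scale a p)) = f (free_scale a (?e p))"
      by (intro eq e)
        (simp_all only: free_scale.eval_single free_scale.eval_scale free_scale.scale_one)
    moreover have "f (free_scale a (?e p)) = sN a (f (?e p))"
      using that by (intro module_homs_scale[OF f] e)
    ultimately show ?thesis
      using that ap by (simp only: h_def if_True)
  qed
  ultimately have "h \<in> module_homs ?K free_scale sN"
    by (simp add: module_homs_def h_def)
  moreover have "f q = h (free_eval free_scale q)" if "q \<in> res1 sM" for q
  proof -
    have "free_eval free_scale q \<in> ?K"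
      using that free_scale.free_eval_in_submodule[OF K] by (simp only: res1_def)
    then show ?thesis
      unfolding h_def using that
      by (simp only: if_True, intro eq e) (simp_all add: res1_def free_scale.scale_one)
  qed
  ultimately show thesis by (rule that)
qed

text \<open>The converse of \<open>ext1_cocycle_factors\<close>: evaluating an element of
  \<open>P2\<close> twice gives 0, so pulling back along evaluation produces a cocycle.\<close>

lemma ext1_cocycleI:
  assumes "left_module sM"
    and add: "\<And>p q. \<lbrakk>p \<in> syzygies UNIV sM; q \<in> syzygies UNIV sM\<rbrakk> \<Longrightarrow> h (p + q) = h p + h q"
    and scale: "\<And>a p. p \<in> syzygies UNIV sM \<Longrightarrow> h (free_scale a p) = sN a (h p)"
  shows "(\<lambda>q. if q \<in> res1 sM then h (free_eval free_scale q) else 0) \<in> ext1_cocycles sM sN"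
proof -
  let ?K = "syzygies UNIV sM"
  note K = submodule_syzygies[OF assms(1), of UNIV]
  note KK = submodule_syzygies[OF free_scale.left_module_axioms, of ?K]
  have "h 0 = 0"
    using add[of 0 0] K by (simp add: submodule_def)
  moreover have "free_eval free_scale (free_eval free_scale r) = 0" if "r \<in> res2 sM" for r
    using free_scale.free_eval_in_submodule[OF KK] that by (simp add: res2_def syzygies_def)
  moreover have "free_eval free_scale q \<in> ?K" if "q \<in> free_module ?K" for q
    using free_scale.free_eval_in_submodule[OF K] that .
  ultimately show ?thesis
    using submodule_free_module[of ?K] add scale
    by (auto simp: ext1_cocycles_def module_homs_def res1_def submodule_def
        free_scale.eval_add free_scale.eval_scale)
qed

section \<open>Dimensions of quotients of function spaces\<close>

lemma quotient_has_dim_family: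
  assumes "finite I" "inj_on b I" "\<And>i. i \<in> I \<Longrightarrow> b i \<in> Z"
    and span: "\<And>z. z \<in> Z \<Longrightarrow> \<exists>c. (\<lambda>q. z q - (\<Sum>i\<in>I. scale (c i) (b i q))) \<in> B"
    and indep: "\<And>c i. \<lbrakk>(\<lambda>q. \<Sum>i\<in>I. scale (c i) (b i q)) \<in> B; i \<in> I\<rbrakk> \<Longrightarrow> c i = 0"
  shows "quotient_has_dim scale Z B (card I)"
  unfolding quotient_has_dim_def
proof (intro exI[of _ "b ` I"] conjI ballI allI impI)
  fix z assume "z \<in> Z"
  then obtain c where "(\<lambda>q. z q - (\<Sum>i\<in>I. scale (c i) (b i q))) \<in> B"
    using span by blast
  then show "\<exists>c. (\<lambda>q. z q - (\<Sum>t\<in>b ` I. scale (c t) (t q))) \<in> B"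
    using assms(2) by (intro exI[of _ "c \<circ> the_inv_into I b"])
      (simp add: sum.reindex the_inv_into_f_f cong: sum.cong)
next
  fix c t assume "(\<lambda>q. \<Sum>t\<in>b ` I. scale (c t) (t q)) \<in> B" "t \<in> b ` I"
  then show "c t = 0"
    using indep[of "c \<circ> b"] assms(2) by (auto simp: sum.reindex)
qed (use assms in \<open>auto simp: card_image\<close>)

text \<open>The linear map \<open>F\<close> induces an isomorphism from \<open>Z' / B'\<close> to
  \<open>Z / B\<close>: \<open>iff\<close> makes it well defined and injective, \<open>surj\<close>
  makes it surjective modulo \<open>B\<close>. Injectivity of \<open>F\<close> itself keeps the
  cardinality of the basis, which is counted as a set of functions.\<close>

lemma quotient_has_dim_transfer:
  fixes F :: "('p \<Rightarrow> 'k) \<Rightarrow> 'q \<Rightarrow> 'k::field"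
  assumes dim: "quotient_has_dim (*) Z' B' n"
    and B'_Z': "B' \<subseteq> Z'" and inj: "inj_on F Z'" and into: "F ` Z' \<subseteq> Z"
    and Z'_comb: "\<And>T c. T \<subseteq> Z' \<Longrightarrow> (\<lambda>s. \<Sum>t\<in>T. c t * t s) \<in> Z'"
    and F_comb: "\<And>T c. F (\<lambda>s. \<Sum>t\<in>T. c t * t s) = (\<lambda>q. \<Sum>t\<in>T. c t * F t q)"
    and F_diff: "\<And>d e. F (\<lambda>s. d s - e s) = (\<lambda>q. F d q - F e q)"
    and B_add: "\<And>z z'. \<lbrakk>z \<in> B; z' \<in> B\<rbrakk> \<Longrightarrow> (\<lambda>q. z q + z' q) \<in> B"
    and iff: "\<And>d. d \<in> Z' \<Longrightarrow> F d \<in> B \<longleftrightarrow> d \<in> B'"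
    and surj: "\<And>z. z \<in> Z \<Longrightarrow> \<exists>d\<in>Z'. (\<lambda>q. z q - F d q) \<in> B"
  shows "quotient_has_dim (*) Z B n"
proof -
  obtain T where T: "T \<subseteq> Z'" "finite T" "card T = n"
    and span: "\<And>z. z \<in> Z' \<Longrightarrow> \<exists>c. (\<lambda>s. z s - (\<Sum>t\<in>T. c t * t s)) \<in> B'"
    and indep: "\<And>c t. \<lbrakk>(\<lambda>s. \<Sum>t\<in>T. c t * t s) \<in> B'; t \<in> T\<rbrakk> \<Longrightarrow> c t = 0"
    using dim unfolding quotient_has_dim_def by blast
  have "quotient_has_dim (*) Z B (card T)"
  proof (rule quotient_has_dim_family[where b = F])
    show "inj_on F T" using inj T(1) by (rule inj_on_subset)
    show "F t \<in> Z" if "t \<in> T" for t using that T(1) into by blast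
  next
    fix z assume "z \<in> Z"
    then obtain d where d: "d \<in> Z'" "(\<lambda>q. z q - F d q) \<in> B"
      using surj by blast
    obtain c where c: "(\<lambda>s. d s - (\<Sum>t\<in>T. c t * t s)) \<in> B'"
      using span d(1) by blast
    then have "F (\<lambda>s. d s - (\<Sum>t\<in>T. c t * t s)) \<in> B"
      using iff B'_Z' by blast
    then have "(\<lambda>q. F d q - (\<Sum>t\<in>T. c t * F t q)) \<in> B"
      by (simp add: F_diff F_comb)
    \<comment> \<open>The two errors, of \<open>z\<close> against \<open>F d\<close> and of
      \<open>F d\<close> against the combination, add up to the required element of
      \<open>B\<close>.\<close>
    from B_add[OF d(2) this]
    show "\<exists>c. (\<lambda>q. z q - (\<Sum>t\<in>T. c t * F t q)) \<in> B"
      by (intro exI[of _ c]) simp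
  next
    fix c t assume "(\<lambda>q. \<Sum>t\<in>T. c t * F t q) \<in> B" "t \<in> T"
    then show "c t = 0"
      using indep[of c] iff[OF Z'_comb[OF T(1)], of c] by (simp add: F_comb)
  qed (use T in simp)
  then show ?thesis using T(3) by simp
qed

section \<open>Extensions of one-dimensional modules of a monoid\<close>

definition linear_ext :: "('s::monoid_mult \<Rightarrow> 'k::field) \<Rightarrow> ('s, 'k) semigroup_algebra \<Rightarrow> 'k"
  where "linear_ext d a =
    (\<Sum>s\<in>Poly_Mapping.keys a. Poly_Mapping.lookup a s * d (of_additive s))"

text \<open>
  A module only if \<open>d\<close> is a character. For a derivation \<open>d\<close>, the map \<open>free_eval (char_module d)\<close>
  restricted to the syzygies is the homomorphism attached to \<open>d\<close>.
\<close>
definition char_module ::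
    "('s::monoid_mult \<Rightarrow> 'k::field) \<Rightarrow> ('s, 'k) semigroup_algebra \<Rightarrow> 'k \<Rightarrow> 'k"
  where "char_module d a v = linear_ext d a * v"

lemma linear_ext_0 [simp]: "linear_ext d 0 = 0"
  by (simp add: linear_ext_def)

lemma linear_ext_single [simp]: "linear_ext d (Poly_Mapping.single s c) = c * d (of_additive s)"
  by (simp add: linear_ext_def)

lemma linear_ext_add: "linear_ext d (a + b) = linear_ext d a + linear_ext d b"
  unfolding linear_ext_def
  by (rule setsum_keys_plus_distrib) (auto simp: distrib_right)

lemma free_eval_char_module_add:
  "free_eval (char_module d) (p + q) = free_eval (char_module d) p + free_eval (char_module d) q"
  by (rule free_eval_add) (simp add: char_module_def linear_ext_add distrib_right)

lemma free_eval_char_module_single [simp]: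
  "free_eval (char_module d) (Poly_Mapping.single v a) = linear_ext d a * v"
  by (subst free_eval_single) (simp_all add: char_module_def)

lemma free_eval_char_module_diff:
  "free_eval (char_module d) (p - q) = free_eval (char_module d) p - free_eval (char_module d) q"
  using free_eval_char_module_add[of d "p - q" q] by (simp add: eq_diff_eq)

lemma free_eval_char_module_sum:
  "free_eval (char_module (\<lambda>s. \<Sum>t\<in>T. c t * d t s)) p =
    (\<Sum>t\<in>T. c t * free_eval (char_module (d t)) p)"
proof -
  have "linear_ext (\<lambda>s. \<Sum>t\<in>T. c t * d t s) a = (\<Sum>t\<in>T. c t * linear_ext (d t) a)" for a
    by (induction a rule: poly_mapping_single_add_induct)
      (simp_all add: linear_ext_add sum.distrib distrib_left sum_distrib_left mult.left_commute)
  then show ?thesis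
    by (induction p rule: poly_mapping_single_add_induct)
      (simp_all add: free_eval_char_module_add sum.distrib distrib_left sum_distrib_right mult.assoc)
qed

lemma free_eval_char_module_minus:
  "free_eval (char_module (\<lambda>s. d s - e s)) p =
    free_eval (char_module d) p - free_eval (char_module e) p"
proof -
  have "linear_ext (\<lambda>s. d s - e s) a = linear_ext d a - linear_ext e a" for a
    by (induction a rule: poly_mapping_single_add_induct)
      (simp_all add: linear_ext_add right_diff_distrib add_diff_eq diff_add_eq diff_diff_add ac_simps)
  then show ?thesis
    by (induction p rule: poly_mapping_single_add_induct)
      (simp_all add: free_eval_char_module_add left_diff_distrib right_diff_distrib
        add_diff_eq diff_add_eq diff_diff_add ac_simps)
qed

lemma free_eval_char_module_mult:
  "free_eval (char_module (\<lambda>s. c * d s)) p = c * free_eval (char_module d) p"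
  using free_eval_char_module_sum[of "\<lambda>_. c" "\<lambda>_. d" "{()}" p] by simp

section \<open>Scalars, characters and derivations\<close>

lemma linear_ext_algebra_const [simp]: "linear_ext d (algebra_const c) = c * d 1"
  by (simp add: algebra_const_def zero_additive_def)

lemma algebra_const_mult_commute: "algebra_const c * a = a * algebra_const c"
  by (induction a rule: poly_mapping_single_add_induct)
    (simp_all add: algebra_const_def mult_single mult.commute distrib_left distrib_right)

lemma algebra_const_mult: "algebra_const (b * c) = algebra_const b * algebra_const c"
  by (simp add: algebra_const_def mult_single)

lemma algebra_const_add: "algebra_const (b + c) = algebra_const b + algebra_const c"
  by (simp add: algebra_const_def single_add)

lemma algebra_const_0 [simp]: "algebra_const 0 = 0"
  by (simp add: algebra_const_def)

lemma algebra_const_1 [simp]: "algebra_const 1 = 1"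
  by (simp add: algebra_const_def)

definition is_char :: "('s::monoid_mult \<Rightarrow> 'k::field) \<Rightarrow> bool"
  where "is_char \<chi> \<longleftrightarrow> \<chi> 1 = 1 \<and> (\<forall>s t. \<chi> (s * t) = \<chi> s * \<chi> t)"

text \<open>For characters \<phi> and \<psi>, these are the \<open>d\<close> for which the upper
  triangular matrices with diagonal \<phi>, \<psi> and corner \<open>d\<close> are multiplicative in
  \<open>s\<close>, that is, the 1-cocycles with values in \<open>k\<close> under left action by
  \<phi> and right action by \<psi>.\<close>

definition derivations :: "('s::monoid_mult \<Rightarrow> 'k::field) \<Rightarrow> ('s \<Rightarrow> 'k) \<Rightarrow> ('s \<Rightarrow> 'k) set"
  where "derivations \<phi> \<psi> = {d. \<forall>s t. d (s * t) = \<phi> s * d t + d s * \<psi> t}"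

definition inner_derivations :: "('s::monoid_mult \<Rightarrow> 'k::field) \<Rightarrow> ('s \<Rightarrow> 'k) \<Rightarrow> ('s \<Rightarrow> 'k) set"
  where "inner_derivations \<phi> \<psi> = range (\<lambda>c s. c * (\<phi> s - \<psi> s))"

lemma linear_ext_derivation:
  assumes "d \<in> derivations \<phi> \<psi>"
  shows "linear_ext d (a * b) = linear_ext \<phi> a * linear_ext d b + linear_ext d a * linear_ext \<psi> b"
proof (induction a rule: poly_mapping_single_add_induct)
  case (single s c)
  show ?case
    using assms
    by (induction b rule: poly_mapping_single_add_induct)
      (simp_all add: mult_single plus_additive_def derivations_def linear_ext_add algebra_simps)
qed (simp_all add: linear_ext_add algebra_simps)

lemma linear_ext_char:
  assumes "is_char \<chi>"
  shows "linear_ext \<chi> (a * b) = linear_ext \<chi> a * linear_ext \<chi> b"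
proof -
  \<comment> \<open>A character is a derivation whose right-hand character is 0.\<close>
  have "\<chi> \<in> derivations \<chi> (\<lambda>_. 0)"
    using assms by (simp add: derivations_def is_char_def)
  moreover have "linear_ext (\<lambda>_. 0) b = 0"
    by (simp add: linear_ext_def)
  ultimately show ?thesis
    using linear_ext_derivation[of \<chi> \<chi> "\<lambda>_. 0" a b] by simp
qed

lemma left_module_char_module:
  assumes "is_char \<chi>"
  shows "left_module (char_module \<chi>)"
proof
  show "char_module \<chi> 1 x = x" for x
    using assms linear_ext_algebra_const[of \<chi> 1] by (simp add: char_module_def is_char_def)
qed (simp_all add: char_module_def linear_ext_add linear_ext_char[OF assms] algebra_simps)

text \<open>On a syzygy of the module of \<psi> the second summand vanishes, so a derivation yields
  a homomorphism from the syzygies to the module of \<phi>.\<close>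

lemma free_eval_char_module_scale:
  assumes "d \<in> derivations \<phi> \<psi>"
  shows "free_eval (char_module d) (free_scale a p) =
    linear_ext \<phi> a * free_eval (char_module d) p + linear_ext d a * free_eval (char_module \<psi>) p"
  by (induction p rule: poly_mapping_single_add_induct)
    (simp_all add: free_scale.scale_right_distrib free_eval_char_module_add
      linear_ext_derivation[OF assms] algebra_simps)

text \<open>
  Applying \<open>h\<close> to the syzygy \<open>s e\<^sub>1 - \<psi>(s) e\<^sub>1\<close> yields a derivation, and \<open>h\<close> differs from the
  homomorphism attached to that derivation by the restriction of a homomorphism of \<open>P\<^sub>0\<close>.
\<close>
lemma syzygy_hom_decomposition:
  fixes \<phi> \<psi> :: "'s::monoid_mult \<Rightarrow> 'k::field"
  assumes \<phi>: "is_char \<phi>" and \<psi>: "is_char \<psi>"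
    and h: "h \<in> module_homs (syzygies UNIV (char_module \<psi>)) free_scale (char_module \<phi>)"
  obtains d g where "d \<in> derivations \<phi> \<psi>"
    and "g \<in> module_homs UNIV free_scale (char_module \<phi>)"
    and "\<And>p. p \<in> syzygies UNIV (char_module \<psi>) \<Longrightarrow> h p = free_eval (char_module d) p + g p"
proof -
  interpret M: left_module "char_module \<psi>" by (rule left_module_char_module[OF \<psi>])
  let ?K = "syzygies UNIV (char_module \<psi>)"
  let ?e = "\<lambda>v a. Poly_Mapping.single v a"
  let ?s = "\<lambda>s c. Poly_Mapping.single (Additive s) c"
  have K: "p \<in> ?K \<longleftrightarrow> free_eval (char_module \<psi>) p = 0" for p
    by (simp add: syzygies_def free_module_def)
  have h_add: "h (p + q) = h p + h q" if "p \<in> ?K" "q \<in> ?K" for p q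
    using h that unfolding module_homs_def by blast
  have h_scale: "h (free_scale a p) = linear_ext \<phi> a * h p" if "p \<in> ?K" for a p
    using h that unfolding module_homs_def char_module_def by blast
  \<comment> \<open>A \<open>k\<close>-linear retraction of \<open>P0\<close> onto the syzygies: it
    subtracts the multiple of the generator \<open>e_1\<close> that has the same value in
    \<open>M\<close>. It need not be linear over the algebra, and \<open>d\<close> and
    \<open>g\<close> record the failure.\<close>
  define ret where "ret p = p - ?e 1 (algebra_const (free_eval (char_module \<psi>) p))" for p
  have ret_K: "ret p \<in> ?K" for p
    using \<psi> by (simp add: K ret_def free_eval_char_module_diff is_char_def)
  have ret_add: "ret (p + q) = ret p + ret q" for p q
    by (simp add: ret_def free_eval_char_module_add algebra_const_add single_add)
  have h0: "h 0 = 0"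
  proof -
    have "h (0 + 0) = h 0 + h 0" by (rule h_add) (simp_all add: K)
    then show ?thesis by (simp only: add_0_left add_cancel_right_right)
  qed
  have ret0: "ret 0 = 0"
    by (simp add: ret_def)
  have ret_single: "ret (?e v a) = ?e v a - ?e 1 (algebra_const (linear_ext \<psi> a * v))" for v a
    by (simp add: ret_def)
  define d where "d s = h (ret (?e 1 (?s s 1)))" for s
  have d_ext: "h (ret (?e 1 a)) = linear_ext d a" for a
  proof (induction a rule: poly_mapping_single_add_induct)
    case (single s c)
    obtain s' where s: "s = Additive s'" by (cases s)
    have "ret (?e 1 (?s s' c)) = free_scale (algebra_const c) (ret (?e 1 (?s s' 1)))"
      by (simp add: ret_def free_scale_diff algebra_const_mult algebra_const_def mult_single)
    then show ?case
      using ret_K \<phi> by (simp add: s h_scale d_def is_char_def)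
  qed (simp_all add: h0 ret0 single_add ret_add h_add ret_K linear_ext_add)
  have "d \<in> derivations \<phi> \<psi>"
    unfolding derivations_def
  proof (intro CollectI allI)
    fix s t
    \<comment> \<open>\<open>s t e_1 - \<psi>(s t) e_1 = s (t e_1 - \<psi>(t) e_1) + \<psi>(t) (s
      e_1 - \<psi>(s) e_1)\<close>, to which \<open>h\<close> is then applied.\<close>
    have "ret (?e 1 (?s (s * t) 1)) =
        free_scale (?s s 1) (ret (?e 1 (?s t 1))) + free_scale (algebra_const (\<psi> t)) (ret (?e 1 (?s s 1)))"
      using \<psi> algebra_const_mult_commute[of "\<psi> t" "?s s 1"]
      by (simp add: ret_single free_scale_diff mult_single plus_additive_def is_char_def
          algebra_const_mult algebra_const_mult_commute[of "\<psi> s" "algebra_const (\<psi> t)"])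
    then show "d (s * t) = \<phi> s * d t + d s * \<psi> t"
      using \<phi> K ret_K submodule_syzygies[OF M.left_module_axioms, of UNIV]
      by (simp add: d_def h_add h_scale submodule_def is_char_def mult.commute)
  qed
  define u where "u v = h (ret (?e v 1))" for v
  \<comment> \<open>The linear extension of \<open>u\<close> from the generators of
    \<open>P0\<close>; \<open>u\<close> itself is an arbitrary function.\<close>
  define g where "g = free_eval (\<lambda>a v. linear_ext \<phi> a * u v)"
  have g_add: "g (p + q) = g p + g q" for p q
    unfolding g_def by (rule free_eval_add) (simp add: linear_ext_add distrib_right)
  have g_single: "g (?e v a) = linear_ext \<phi> a * u v" for v a
    unfolding g_def by (rule free_eval_single) simp
  have "g (free_scale a p) = linear_ext \<phi> a * g p" for a p
    by (induction p rule: poly_mapping_single_add_induct)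
      (simp_all add: g_def[THEN fun_cong, of 0] g_single g_add free_scale.scale_right_distrib
        linear_ext_char[OF \<phi>] distrib_left)
  then have "g \<in> module_homs UNIV free_scale (char_module \<phi>)"
    by (simp add: module_homs_def g_add char_module_def)
  have "h (ret p) = free_eval (char_module d) p + g p" for p
  proof (induction p rule: poly_mapping_single_add_induct)
    case (single v a)
    \<comment> \<open>\<open>a e_v - \<psi>(a) v e_1 = a (e_v - v e_1) + v (a e_1 - \<psi>(a)
      e_1)\<close>: under \<open>h\<close> the first summand gives \<open>g\<close> and the second
      the homomorphism of \<open>d\<close>.\<close>
    have "ret (?e v a) = free_scale a (ret (?e v 1)) + free_scale (algebra_const v) (ret (?e 1 a))"
      using \<psi> linear_ext_algebra_const[of \<psi> 1] algebra_const_mult_commute[of v a]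
      by (simp add: ret_single free_scale_diff is_char_def algebra_const_mult
          algebra_const_mult_commute[of v "algebra_const _"])
    then show ?case
      using \<phi> K ret_K submodule_syzygies[OF M.left_module_axioms, of UNIV]
      by (simp add: h_add h_scale submodule_def d_ext u_def g_single is_char_def mult.commute)
  qed (simp_all add: h0 ret0 g_def[THEN fun_cong, of 0] ret_add h_add ret_K g_add
      free_eval_char_module_add)
  moreover have "ret p = p" if "p \<in> ?K" for p
    using that by (simp add: K ret_def)
  ultimately have "h p = free_eval (char_module d) p + g p" if "p \<in> ?K" for p
    using that by metis
  with \<open>d \<in> _\<close> \<open>g \<in> _\<close> show thesis by (rule that)
qed

text \<open>The map \<open>F\<close> sends a derivation to its homomorphism on the syzygies, pulled
  back to \<open>P1\<close>; it matches derivations modulo inner ones with cocycles modulo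
  coboundaries.\<close>

lemma ext1_char_module_dim:
  fixes \<phi> \<psi> :: "'s::monoid_mult \<Rightarrow> 'k::field"
  assumes \<phi>: "is_char \<phi>" and \<psi>: "is_char \<psi>"
    and dim: "quotient_has_dim (*) (derivations \<phi> \<psi>) (inner_derivations \<phi> \<psi>) n"
  shows "ext1_has_dim algebra_const (char_module \<psi>) (char_module \<phi>) n"
proof -
  let ?M = "char_module \<psi>" and ?N = "char_module \<phi>"
  let ?K = "syzygies UNIV ?M"
  let ?e = "\<lambda>a. Poly_Mapping.single 1 a :: 'k \<Rightarrow>\<^sub>0 ('s, 'k) semigroup_algebra"
  let ?s = "\<lambda>s. Poly_Mapping.single (Additive s) 1 :: ('s, 'k) semigroup_algebra"
  interpret M: left_module ?M by (rule left_module_char_module[OF \<psi>])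
  interpret N: left_module ?N by (rule left_module_char_module[OF \<phi>])
  define F where "F d q = (if q \<in> res1 ?M then
      free_eval (char_module d) (free_eval free_scale q) else 0)" for d :: "'s \<Rightarrow> 'k" and q
  have res1_K: "free_eval free_scale q \<in> ?K" if "q \<in> res1 ?M" for q
    using that free_scale.free_eval_in_submodule[OF submodule_syzygies[OF M.left_module_axioms]]
    by (simp add: res1_def)
  have K: "p \<in> ?K \<longleftrightarrow> free_eval ?M p = 0" for p
    by (simp add: syzygies_def free_module_def)
  \<comment> \<open>The syzygy \<open>s e_1 - \<psi>(s) e_1\<close>. Evaluating \<open>F d\<close>
    at its generator recovers \<open>d s\<close>, because the second term contributes a multiple of
    \<open>d 1 = 0\<close>.\<close>
  define \<kappa> where "\<kappa> s = ?e (?s s) - ?e (algebra_const (\<psi> s))" for s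
  have \<kappa>_K: "\<kappa> s \<in> ?K" for s
    using \<psi> by (simp add: K \<kappa>_def free_eval_char_module_diff is_char_def)
  have \<kappa>_res1: "Poly_Mapping.single (\<kappa> s) 1 \<in> res1 ?M" for s
    using \<kappa>_K by (simp add: res1_def free_module_def)
  have d_1: "d 1 = 0" if "d \<in> derivations \<phi> \<psi>" for d
  proof -
    have "d (1 * 1) = \<phi> 1 * d 1 + d 1 * \<psi> 1"
      using that by (simp only: derivations_def mem_Collect_eq)
    then have "d 1 = d 1 + d 1"
      using \<phi> \<psi> by (simp only: is_char_def mult_1_left mult_1_right)
    then show ?thesis
      by (simp only: add_cancel_right_right)
  qed
  have F_\<kappa>: "F d (Poly_Mapping.single (\<kappa> s) 1) = d s" if "d \<in> derivations \<phi> \<psi>" for d s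
    using \<kappa>_res1 d_1[OF that]
    by (simp add: F_def free_scale.scale_one) (simp add: \<kappa>_def free_eval_char_module_diff)
  have hom_diff: "g (p - q) = g p - g q" if "g \<in> module_homs (res0 ?M) free_scale ?N" for g p q
    using module_homs_diff[OF free_scale.left_module_axioms submodule_free_module
        that[unfolded res0_def]]
    by (simp add: free_module_def)
  have hom_scale: "g (free_scale a p) = linear_ext \<phi> a * g p"
    if "g \<in> module_homs (res0 ?M) free_scale ?N" for g p a
    using that by (auto simp: res0_def free_module_def module_homs_def char_module_def)
  have cob: "z \<in> ext1_coboundaries ?M ?N \<longleftrightarrow> (\<exists>g\<in>module_homs (res0 ?M) free_scale ?N.
      z = (\<lambda>q. if q \<in> res1 ?M then g (free_eval free_scale q) else 0))" for z
    unfolding ext1_coboundaries_def image_iff ..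
  have "quotient_has_dim (*) (ext1_cocycles ?M ?N) (ext1_coboundaries ?M ?N) n"
  proof (rule quotient_has_dim_transfer[OF dim, where F = F])
    show "inner_derivations \<phi> \<psi> \<subseteq> derivations \<phi> \<psi>"
      using \<phi> \<psi> by (auto simp: inner_derivations_def derivations_def is_char_def algebra_simps)
    show "inj_on F (derivations \<phi> \<psi>)"
      by (rule inj_onI) (metis F_\<kappa> ext)
    show "F ` derivations \<phi> \<psi> \<subseteq> ext1_cocycles ?M ?N"
    proof (rule image_subsetI)
      fix d assume d: "d \<in> derivations \<phi> \<psi>"
      show "F d \<in> ext1_cocycles ?M ?N"
        unfolding F_def
        by (rule ext1_cocycleI[OF M.left_module_axioms])
          (simp_all add: free_eval_char_module_add free_eval_char_module_scale[OF d] K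
            char_module_def[of \<phi>])
    qed
    show "(\<lambda>s. \<Sum>t\<in>T. c t * t s) \<in> derivations \<phi> \<psi>" if "T \<subseteq> derivations \<phi> \<psi>" for T c
    proof -
      have "t (r * s) = \<phi> r * t s + t r * \<psi> s" if "t \<in> T" for t r s
        using that \<open>T \<subseteq> _\<close> unfolding derivations_def by blast
      then have "(\<Sum>t\<in>T. c t * t (r * s)) = (\<Sum>t\<in>T. c t * (\<phi> r * t s + t r * \<psi> s))" for r s
        by (intro sum.cong) simp_all
      then have "(\<Sum>t\<in>T. c t * t (r * s)) =
          \<phi> r * (\<Sum>t\<in>T. c t * t s) + (\<Sum>t\<in>T. c t * t r) * \<psi> s" for r s
        by (simp add: sum_distrib_left sum_distrib_right distrib_left sum.distrib ac_simps)
      then show ?thesis by (simp add: derivations_def)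
    qed
    show "F (\<lambda>s. \<Sum>t\<in>T. c t * t s) = (\<lambda>q. \<Sum>t\<in>T. c t * F t q)" for T c
      by (auto simp: F_def fun_eq_iff free_eval_char_module_sum)
    show "F (\<lambda>s. d s - e s) = (\<lambda>q. F d q - F e q)" for d e
      by (auto simp: F_def fun_eq_iff free_eval_char_module_minus)
  next
    fix z z' assume "z \<in> ext1_coboundaries ?M ?N" "z' \<in> ext1_coboundaries ?M ?N"
    then obtain g g' where g: "g \<in> module_homs (res0 ?M) free_scale ?N"
        "g' \<in> module_homs (res0 ?M) free_scale ?N"
      and "z = (\<lambda>q. if q \<in> res1 ?M then g (free_eval free_scale q) else 0)"
        "z' = (\<lambda>q. if q \<in> res1 ?M then g' (free_eval free_scale q) else 0)"
      unfolding cob by (elim bexE)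
    then show "(\<lambda>q. z q + z' q) \<in> ext1_coboundaries ?M ?N"
      unfolding cob
      by (intro bexI[of _ "\<lambda>p. g p + g' p"])
        (auto simp: module_homs_def N.scale_right_distrib add_ac)
  next
    fix d assume d: "d \<in> derivations \<phi> \<psi>"
    show "F d \<in> ext1_coboundaries ?M ?N \<longleftrightarrow> d \<in> inner_derivations \<phi> \<psi>"
    proof
      assume "F d \<in> ext1_coboundaries ?M ?N"
      then obtain g where g: "g \<in> module_homs (res0 ?M) free_scale ?N"
        and Fd: "F d = (\<lambda>q. if q \<in> res1 ?M then g (free_eval free_scale q) else 0)"
        unfolding cob by (elim bexE)
      \<comment> \<open>A homomorphism \<open>g\<close> on all of \<open>P0\<close> splits over the
        two terms of \<open>\<kappa> s\<close>, which exhibits \<open>g(e_1)\<close> as the constant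
        of the inner derivation.\<close>
      have "d s = g (?e 1) * (\<phi> s - \<psi> s)" for s
      proof -
        have "d s = g (\<kappa> s)"
          using F_\<kappa>[OF d, of s] \<kappa>_res1 by (simp add: Fd free_scale.scale_one)
        also have "\<kappa> s = free_scale (?s s) (?e 1) - free_scale (algebra_const (\<psi> s)) (?e 1)"
          by (simp add: \<kappa>_def)
        finally show ?thesis
          using \<phi> by (simp only: hom_diff[OF g] hom_scale[OF g])
            (simp add: is_char_def algebra_simps)
      qed
      then show "d \<in> inner_derivations \<phi> \<psi>"
        unfolding inner_derivations_def by blast
    next
      assume "d \<in> inner_derivations \<phi> \<psi>"
      then obtain c where c: "d = (\<lambda>s. c * (\<phi> s - \<psi> s))"
        unfolding inner_derivations_def by blast
      \<comment> \<open>The homomorphism of \<open>c (\<phi> - \<psi>)\<close> is \<open>c\<close>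
        times the difference of the evaluations into \<open>N\<close> and \<open>M\<close>. The
        latter vanishes on syzygies and the former is defined on all of \<open>P0\<close>.\<close>
      have "(\<lambda>p. c * free_eval ?N p) \<in> module_homs (res0 ?M) free_scale ?N"
        by (auto simp: module_homs_def res0_def free_module_def N.eval_add N.eval_scale
            char_module_def algebra_simps)
      moreover have "F d = (\<lambda>q. if q \<in> res1 ?M then c * free_eval ?N (free_eval free_scale q) else 0)"
        using res1_K
        by (auto simp: F_def fun_eq_iff c free_eval_char_module_mult free_eval_char_module_minus K)
      ultimately show "F d \<in> ext1_coboundaries ?M ?N"
        unfolding cob by (intro bexI[of _ "\<lambda>p. c * free_eval ?N p"])
    qed
  next
    fix z assume z: "z \<in> ext1_cocycles ?M ?N"
    obtain h where h: "h \<in> module_homs ?K free_scale ?N"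
        "\<And>q. q \<in> res1 ?M \<Longrightarrow> z q = h (free_eval free_scale q)"
      using ext1_cocycle_factors[OF M.left_module_axioms z] by blast
    obtain d g where d: "d \<in> derivations \<phi> \<psi>" and g: "g \<in> module_homs UNIV free_scale ?N"
      and eq: "\<And>p. p \<in> ?K \<Longrightarrow> h p = free_eval (char_module d) p + g p"
      using syzygy_hom_decomposition[OF \<phi> \<psi> h(1)] by blast
    have "z q = 0" if "q \<notin> res1 ?M" for q
      using z that by (simp add: ext1_cocycles_def module_homs_def)
    then have "(\<lambda>q. z q - F d q) =
        (\<lambda>q. if q \<in> res1 ?M then g (free_eval free_scale q) else 0)"
      by (auto simp: F_def fun_eq_iff h(2) eq res1_K)
    moreover have "g \<in> module_homs (res0 ?M) free_scale ?N"
      using g by (simp add: res0_def free_module_def)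
    ultimately show "\<exists>d\<in>derivations \<phi> \<psi>. (\<lambda>q. z q - F d q) \<in> ext1_coboundaries ?M ?N"
      using d unfolding cob by (intro bexI[of _ d] bexI[of _ g])
  qed
  moreover have "(\<lambda>c. ?N (algebra_const c)) = (*)"
    using \<phi> by (auto simp: fun_eq_iff char_module_def is_char_def)
  ultimately show ?thesis
    by (simp add: ext1_has_dim_def)
qed

section \<open>Derivations of left regular bands\<close>

lemma supp_surj: "\<exists>x. supp x = X"
  by (metis Quotient_abs_rep Quotient_support)

text \<open>Supports turn products into joins. If \<open>x s t = x\<close>, then
  \<open>x s = x s t s = x s t = x\<close> by left regularity, and \<open>x t = x\<close>
  follows.\<close>

lemma supp_mult_le_iff: "supp (s * t) \<le> X \<longleftrightarrow> supp s \<le> X \<and> supp t \<le> X"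
proof -
  obtain x where X: "X = supp x" using supp_surj by metis
  have "x * s = x \<and> x * t = x" if "x * (s * t) = x"
    using that by (metis idem left_regular mult.assoc)
  moreover have "x * (s * t) = x" if "x * s = x" "x * t = x"
    using that by (metis mult.assoc)
  ultimately show ?thesis
    unfolding X supp_le_iff by blast
qed

lemma supp_1_le: "supp (1 :: 's::left_regular_band_1) \<le> X"
  by (metis supp_surj mult_1_right supp_le_iff)

lemma is_char_supp_char: "is_char (supp_char X :: 's::left_regular_band_1 \<Rightarrow> 'k::field)"
  by (auto simp: is_char_def supp_char_def supp_mult_le_iff supp_1_le)

lemma supp_module_eq: "supp_module X = char_module (supp_char X)"
  by (simp add: fun_eq_iff supp_module_def char_module_def linear_ext_def)

lemma supp_mult_eq: "supp s \<le> supp x \<Longrightarrow> supp (s * x) = supp x"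
  by (metis order.refl order.antisym supp_mult_le_iff)

text \<open>Where the two characters agree, \<open>s s = s\<close> gives \<open>d s = 2 d s\<close>
  or \<open>d s = 0\<close>, which forces \<open>d s = 0\<close> in every characteristic.\<close>

lemma derivation_eq_0_if_supp_le_iff:
  fixes d :: "'s::left_regular_band_1 \<Rightarrow> 'k::field"
  assumes d: "d \<in> derivations (supp_char Y) (supp_char X)"
    and s: "supp s \<le> X \<longleftrightarrow> supp s \<le> Y"
  shows "d s = 0"
proof -
  have "d (s * s) = supp_char Y s * d s + d s * supp_char X s"
    using d unfolding derivations_def by blast
  then have "d s = d s + d s \<or> d s = 0"
    using s by (cases "supp s \<le> X") (auto simp: idem supp_char_def)
  then show ?thesis
    by (metis add_cancel_right_right)
qed

lemma derivations_inner_if_not_less: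
  fixes X Y :: "'s::left_regular_band_1 support"
  assumes "\<not> Y < X"
  shows "derivations (supp_char Y) (supp_char X :: 's \<Rightarrow> 'k::field) \<subseteq>
    inner_derivations (supp_char Y) (supp_char X)"
proof
  fix d :: "'s \<Rightarrow> 'k" assume d: "d \<in> derivations (supp_char Y) (supp_char X)"
  have mult: "d (s * t) = supp_char Y s * d t + d s * supp_char X t" for s t
    using d unfolding derivations_def by blast
  show "d \<in> inner_derivations (supp_char Y) (supp_char X)"
  proof (cases "X = Y")
    case True
    then have "d = (\<lambda>s. 0 * (supp_char Y s - supp_char X s))"
      using derivation_eq_0_if_supp_le_iff[OF d] by (simp add: fun_eq_iff)
    then show ?thesis
      unfolding inner_derivations_def by blast
  next
    case False
    obtain y where y: "supp y = Y" using supp_surj by blast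
    have "\<not> Y \<le> X" using assms False by (simp add: order.strict_iff_order)
    \<comment> \<open>Both sides compute \<open>d (y t y) = d (y t)\<close>, using \<chi>_Y(y) = 1
      and \<chi>_X(y) = 0. Solving for \<open>d t\<close> shows that \<open>d\<close> is inner with
      constant \<open>d y\<close>.\<close>
    have key: "supp_char Y t * d y = d t + d y * supp_char X t" for t
      using mult[of "y * t" y] mult[of y t] \<open>\<not> Y \<le> X\<close> y
      by (simp add: left_regular supp_char_def supp_mult_le_iff split: if_splits)
    have "d t = d y * (supp_char Y t - supp_char X t)" for t
      using key[of t] by (simp add: algebra_simps)
    then show ?thesis
      unfolding inner_derivations_def by blast
  qed
qed

section \<open>Derivations in the case Y < X\<close>

context
  fixes X Y :: "'s::{finite,left_regular_band_1} support" and y :: 's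
  assumes less: "Y < X" and y: "supp y = Y"
begin

lemma derivation_right_mult:
  fixes d :: "'s \<Rightarrow> 'k::field"
  assumes "d \<in> derivations (supp_char Y) (supp_char X)" "\<not> supp s \<le> Y" "supp t \<le> X"
  shows "d (s * t) = d s"
  using assms unfolding derivations_def by (auto simp: supp_char_def)

lemma derivation_left_mult:
  fixes d :: "'s \<Rightarrow> 'k::field"
  assumes "d \<in> derivations (supp_char Y) (supp_char X)" "supp s \<le> Y"
  shows "d (s * t) = d t"
proof -
  have "d s = 0"
    using derivation_eq_0_if_supp_le_iff[OF assms(1), of s] assms(2) less by auto
  then show ?thesis
    using assms unfolding derivations_def by (auto simp: supp_char_def)
qed

lemma derivation_eq_0:
  fixes d :: "'s \<Rightarrow> 'k::field"
  assumes "d \<in> derivations (supp_char Y) (supp_char X)" "supp s \<le> Y \<or> \<not> supp s \<le> X"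
  shows "d s = 0"
  using derivation_eq_0_if_supp_le_iff[OF assms(1), of s] assms(2) less by auto

lemma lrb_less_not_supp_le:
  assumes "lrb_less y w"
  shows "\<not> supp w \<le> Y"
  using assms y by (auto simp: lrb_less_def lrb_le_def supp_le_iff)

lemma derivation_smile:
  fixes d :: "'s \<Rightarrow> 'k::field"
  assumes d: "d \<in> derivations (supp_char Y) (supp_char X)" and "smile y X x x'"
  shows "d x = d x'"
proof -
  obtain w where w: "lrb_less y w" "w * (y * x) = y * x" "w * (y * x') = y * x'"
    and x: "supp x = X" "supp x' = X"
    using assms(2) by (auto simp: smile_def supp_fiber_def lrb_le_def)
  have "d z = d w" if "w * (y * z) = y * z" "supp z = X" for z
  proof -
    have "d z = d (w * (y * z))"
      using derivation_left_mult[OF d, of y z] y that(1) by simp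
    also have "\<dots> = d w"
      using derivation_right_mult[OF d lrb_less_not_supp_le[OF w(1)]] that(2) less y
      by (simp add: supp_mult_le_iff)
    finally show ?thesis .
  qed
  then show ?thesis using w(2,3) x by simp
qed

lemma derivation_equivclp_smile:
  fixes d :: "'s \<Rightarrow> 'k::field"
  assumes d: "d \<in> derivations (supp_char Y) (supp_char X)" and "equivclp (smile y X) x x'"
  shows "d x = d x'"
  using assms(2)
  by (induction rule: equivclp_induct) (auto dest: derivation_smile[OF d])

text \<open>The witness is \<open>y * s\<close>; it lies strictly above \<open>y\<close> since
  \<open>y * s = y\<close> would put the support of \<open>s\<close> below \<open>Y\<close>.\<close>

lemma smileI:
  assumes "supp x = X" "supp x' = X" "\<not> supp s \<le> Y"
    and "y * s * (y * x) = y * x" "y * s * (y * x') = y * x'"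
  shows "smile y X x x'"
proof -
  have "lrb_less y (y * s)"
    using assms(3) y by (metis lrb_less_def lrb_le_def idem mult.assoc supp_le_iff)
  then show ?thesis
    using assms unfolding smile_def supp_fiber_def lrb_le_def by blast
qed

text \<open>Right multiplication by \<open>x0\<close> moves every \<open>s\<close> with support
  below \<open>X\<close> into the fibre, so a function constant on classes extends to a derivation.
  In \<open>left\<close> and \<open>right\<close> the two arguments of \<open>f\<close> are related
  through the witnesses \<open>y * t\<close> and \<open>y * s\<close>.\<close>

lemma derivation_from_fiber:
  fixes f :: "'s \<Rightarrow> 'k::field"
  assumes f: "\<And>x x'. smile y X x x' \<Longrightarrow> f x = f x'" and x0: "supp x0 = X"
  shows "(\<lambda>s. if supp s \<le> X \<and> \<not> supp s \<le> Y then f (s * x0) else 0)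
    \<in> derivations (supp_char Y) (supp_char X)"
proof -
  have fib: "supp (s * x0) = X" if "supp s \<le> X" for s
    using that x0 supp_mult_eq by blast
  have absorb: "y * s * (y * (s * z)) = y * (s * z)" for s z
    by (metis idem left_regular mult.assoc)
  have left: "f (s * t * x0) = f (t * x0)"
    if "supp s \<le> Y" "supp t \<le> X" "\<not> supp t \<le> Y" for s t
  proof (rule f, rule smileI[where s = t])
    have ys: "y * s = y" using that(1) y by (simp add: supp_le_iff[symmetric])
    have "supp s \<le> X" using that(1) less by simp
    with that(2) show "supp (s * t * x0) = X" "supp (t * x0) = X"
      by (simp_all add: fib supp_mult_le_iff)
    show "y * t * (y * (t * x0)) = y * (t * x0)" by (rule absorb)
    then show "y * t * (y * (s * t * x0)) = y * (s * t * x0)"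
      by (metis ys mult.assoc)
  qed (use that in simp)
  have right: "f (s * t * x0) = f (s * x0)"
    if "supp s \<le> X" "\<not> supp s \<le> Y" "supp t \<le> X" for s t
  proof (rule f, rule smileI[where s = s])
    show "y * s * (y * (s * t * x0)) = y * (s * t * x0)"
      using absorb[of s "t * x0"] by (simp add: mult.assoc)
  qed (use that absorb in \<open>simp_all add: fib supp_mult_le_iff\<close>)
  let ?d = "\<lambda>s. if supp s \<le> X \<and> \<not> supp s \<le> Y then f (s * x0) else 0"
  have "?d (s * t) = supp_char Y s * ?d t + ?d s * supp_char X t" for s t
  proof (cases "supp s \<le> Y")
    case True
    then have "supp s \<le> X" using less by simp
    with True show ?thesis
      using left[OF True, of t] by (simp add: supp_char_def supp_mult_le_iff)
  next
    case False
    then show ?thesis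
      using right[of s t] by (simp add: supp_char_def supp_mult_le_iff)
  qed
  then show ?thesis
    unfolding derivations_def by blast
qed

text \<open>The indicators of the classes in the fibre extend to a basis of the derivations. Their
  sum is \<chi>_X - \<chi>_Y, which spans the inner ones, so one class can be discarded; this is the
  \<open>- 1\<close> in \<open>arrow_number\<close>.\<close>

lemma arrow_number_less_dim:
  "quotient_has_dim (*) (derivations (supp_char Y) (supp_char X :: 's \<Rightarrow> 'k::field))
    (inner_derivations (supp_char Y) (supp_char X)) (arrow_number y X Y)"
proof -
  define E where "E = {(x, x'). equivclp (smile y X) x x'}"
  have E_iff: "(x, x') \<in> E \<longleftrightarrow> equivclp (smile y X) x x'" for x x'
    by (simp add: E_def)
  \<comment> \<open>\<open>equivclp\<close> is reflexive everywhere, so \<open>E\<close> is an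
    equivalence on the whole band; points off the fibre are singleton classes.\<close>
  have equivE: "equiv UNIV E"
    by (auto intro!: equivI refl_onI symI transI simp: E_iff intro: equivclp_sym equivclp_trans)
  obtain x0 where x0: "supp x0 = X" using supp_surj by blast
  define C0 where "C0 = E `` {x0}"
  \<comment> \<open>The discarded class is that of \<open>x0\<close>, so every combination over
    \<open>I\<close> vanishes at \<open>x0\<close>.\<close>
  define I where "I = supp_fiber X // E - {C0}"
  define T where "T s \<longleftrightarrow> supp s \<le> X \<and> \<not> supp s \<le> Y" for s :: 's
  define b :: "'s set \<Rightarrow> 's \<Rightarrow> 'k" where
    "b C s = (if T s then if s * x0 \<in> C then 1 else 0 else 0)" for C s
  have T_fiber: "T x" if "supp x = X" for x
    using that less by (simp add: T_def)
  have fiber_mult: "x * x0 = x" if "supp x = X" for x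
    using that x0 by (simp add: supp_le_iff[symmetric])
  have mult_fiber: "supp (s * x0) = X" if "T s" for s
    using that x0 supp_mult_eq by (auto simp: T_def)
  have fin: "finite (supp_fiber X // E)"
    by simp
  have class_eq: "C = E `` {x}" if "C \<in> supp_fiber X // E" "x \<in> C" for C x
    using that equivE by (auto simp: quotient_def equiv_class_eq_iff)
  have class_in: "x \<in> E `` {x}" for x
    by (simp add: E_iff)
  have quot: "E `` {x} \<in> supp_fiber X // E" if "supp x = X" for x
    using that by (auto simp: supp_fiber_def intro: quotientI)
  have rep: "\<exists>x. supp x = X \<and> C = E `` {x}" if "C \<in> supp_fiber X // E" for C
    using that by (auto simp: quotient_def supp_fiber_def)
  have b_class: "b C (x :: 's) = (if C = E `` {x} then 1 else 0)"
    if "C \<in> supp_fiber X // E" "supp x = X" for C x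
  proof -
    have "x \<in> C \<longleftrightarrow> C = E `` {x}"
      using class_eq[OF that(1), of x] class_in[of x] by metis
    with that(2) show ?thesis
      by (simp add: b_def T_fiber fiber_mult)
  qed
  have sum_b: "(\<Sum>C\<in>I. c C * b C x) = (if E `` {x} = C0 then 0 else c (E `` {x}))"
    if "supp x = X" for c x
  proof -
    have "(\<Sum>C\<in>I. c C * b C x) = (\<Sum>C\<in>I. if C = E `` {x} then c C else 0)"
      by (rule sum.cong) (auto simp: b_class that I_def)
    also have "\<dots> = (if E `` {x} = C0 then 0 else c (E `` {x}))"
      using fin quot[OF that] by (auto simp: I_def)
    finally show ?thesis .
  qed
  have "quotient_has_dim (*) (derivations (supp_char Y) (supp_char X :: 's \<Rightarrow> 'k))
    (inner_derivations (supp_char Y) (supp_char X)) (card I)"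
  proof (rule quotient_has_dim_family[where b = b])
    show "finite I" using fin by (simp add: I_def)
    show "inj_on b I"
    proof (rule inj_onI)
      fix C C' assume C: "C \<in> I" "C' \<in> I" "b C = b C'"
      then obtain x where x: "supp x = X" "C = E `` {x}"
        using rep by (auto simp: I_def)
      have "b C' x = 1"
        using b_class[of C x] x C by (simp add: I_def)
      then show "C = C'"
        using b_class[of C' x] x C by (auto simp: I_def split: if_splits)
    qed
    show "b C \<in> derivations (supp_char Y) (supp_char X)" if "C \<in> I" for C
    proof -
      have "(x \<in> C) = (x' \<in> C)" if "smile y X x x'" for x x'
      proof -
        have "equivclp (smile y X) x x'" using that by auto
        moreover obtain x1 where "C = E `` {x1}"
          using rep \<open>C \<in> I\<close> by (auto simp: I_def)
        ultimately show ?thesis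
          by (auto simp: E_iff intro: equivclp_trans[OF _ equivclp_sym] equivclp_trans)
      qed
      then show ?thesis
        unfolding b_def[abs_def] T_def by (intro derivation_from_fiber x0) auto
    qed
  next
    fix z :: "'s \<Rightarrow> 'k" assume z: "z \<in> derivations (supp_char Y) (supp_char X)"
    \<comment> \<open>Since \<open>z\<close> is constant on classes, the choice of representative
      does not matter. Subtracting \<open>z x0\<close> makes the coefficient of \<open>C0\<close>
      zero and leaves the inner derivation with constant \<open>- z x0\<close> as the
      remainder.\<close>
    define c where "c C = z (SOME x. x \<in> C) - z x0" for C
    have c_class: "c (E `` {x}) = z x - z x0" for x
    proof -
      have "(SOME x'. x' \<in> E `` {x}) \<in> E `` {x}"
        using class_in by (rule someI)
      then show ?thesis
        using derivation_equivclp_smile[OF z] by (auto simp: c_def E_iff)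
    qed
    have "z s - (\<Sum>C\<in>I. c C * b C s) = - z x0 * (supp_char Y s - supp_char X s)" for s
    proof (cases "T s")
      case True
      have "b C s = b C (s * x0)" for C
        using True mult_fiber[OF True] by (simp add: b_def T_fiber mult.assoc idem)
      then have "(\<Sum>C\<in>I. c C * b C s) = (\<Sum>C\<in>I. c C * b C (s * x0))"
        by simp
      also have "\<dots> = z (s * x0) - z x0"
        using c_class[of "s * x0"] c_class[of x0]
        by (subst sum_b[OF mult_fiber[OF True]]) (auto simp: C0_def)
      also have "z (s * x0) = z s"
        using True derivation_right_mult[OF z] x0 by (simp add: T_def)
      finally show ?thesis
        using True by (simp add: T_def supp_char_def)
    next
      case False
      then show ?thesis
        using derivation_eq_0[OF z, of s] less
        by (auto simp: T_def b_def supp_char_def)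
    qed
    then show "\<exists>c. (\<lambda>s. z s - (\<Sum>C\<in>I. c C * b C s))
        \<in> inner_derivations (supp_char Y) (supp_char X)"
      unfolding inner_derivations_def by (intro exI[of _ c] range_eqI[of _ _ "- z x0"]) auto
  next
    fix c C assume "(\<lambda>s. \<Sum>C\<in>I. c C * b C s)
        \<in> inner_derivations (supp_char Y) (supp_char X)" and C: "C \<in> I"
    then obtain e where
      "(\<lambda>s. \<Sum>C\<in>I. c C * b C s) = (\<lambda>s. e * (supp_char Y s - supp_char X s))"
      unfolding inner_derivations_def by (elim imageE)
    note e = fun_cong[OF this]
    have diff: "supp_char Y x - supp_char X x = (- 1 :: 'k)" if "supp x = X" for x
      using that less by (simp add: supp_char_def)
    \<comment> \<open>At \<open>x0\<close> the combination is 0, while the inner derivation takes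
      the value \<open>- e\<close>.\<close>
    have "e = 0"
      using e[of x0] sum_b[OF x0, of c] diff[OF x0] by (simp add: C0_def)
    obtain x where "supp x = X" "C = E `` {x}"
      using rep C by (auto simp: I_def)
    then show "c C = 0"
      using e[of x] sum_b[of x c] C \<open>e = 0\<close> by (simp add: I_def)
  qed
  moreover have "card I = arrow_number y X Y"
    using less fin quot[OF x0] by (simp add: arrow_number_def I_def C0_def E_def[symmetric])
  ultimately show ?thesis by simp
qed

end

lemma arrow_number_dim:
  fixes X Y :: "'s::{finite,left_regular_band_1} support"
  assumes "supp y = Y"
  shows "quotient_has_dim (*) (derivations (supp_char Y) (supp_char X :: 's \<Rightarrow> 'k::field))
    (inner_derivations (supp_char Y) (supp_char X)) (arrow_number y X Y)"
proof (cases "Y < X")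
  case False
  \<comment> \<open>Every derivation is inner and the arrow number is 0, so the empty set serves as
    basis.\<close>
  then show ?thesis
    using derivations_inner_if_not_less[OF False]
    by (auto simp: quotient_has_dim_def arrow_number_def intro!: exI[of _ "{}"])
qed (use assms arrow_number_less_dim in blast)

section \<open>Simple modules\<close>

lemma simple_supp_module:
  "simple_module (supp_module X :: ('s::left_regular_band_1, 'k::field) semigroup_algebra \<Rightarrow> 'k \<Rightarrow> 'k)"
  unfolding simple_module_def
proof (intro conjI allI impI)
  show "left_module (supp_module X :: ('s, 'k) semigroup_algebra \<Rightarrow> 'k \<Rightarrow> 'k)"
    unfolding supp_module_eq by (rule left_module_char_module[OF is_char_supp_char])
  show "(UNIV :: 'k set) \<noteq> {0}"
    by (metis UNIV_I singletonD zero_neq_one)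
next
  fix W assume W: "submodule (supp_module X :: ('s, 'k) semigroup_algebra \<Rightarrow> 'k \<Rightarrow> 'k) W"
  show "W = {0} \<or> W = UNIV"
  proof (rule disjCI)
    assume "W \<noteq> UNIV"
    have "w = 0" if "w \<in> W" for w
    proof (rule ccontr)
      assume "w \<noteq> 0"
      have "v \<in> W" for v
      proof -
        have "supp_module X (algebra_const (v / w)) w \<in> W"
          using W that unfolding submodule_def by blast
        then show ?thesis
          using \<open>w \<noteq> 0\<close> by (simp add: supp_module_eq char_module_def supp_char_def supp_1_le)
      qed
      then show False using \<open>W \<noteq> UNIV\<close> by blast
    qed
    then show "W = {0}" using W by (auto simp: submodule_def)
  qed
qed

text \<open>An isomorphism is compared with the action of \<open>s\<close> on 1: the two characters
  agree, so \<open>X\<close> and \<open>Y\<close> lie above the same supports.\<close>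

lemma supp_module_isomorphic_imp_eq:
  fixes X Y :: "'s::left_regular_band_1 support"
  assumes "module_isomorphic (supp_module X :: ('s, 'k::field) semigroup_algebra \<Rightarrow> 'k \<Rightarrow> 'k)
    (supp_module Y :: ('s, 'k) semigroup_algebra \<Rightarrow> 'k \<Rightarrow> 'k)"
  shows "X = Y"
proof -
  obtain f where f: "f \<in> module_homs UNIV (supp_module X :: ('s, 'k) semigroup_algebra \<Rightarrow> 'k \<Rightarrow> 'k)
      (supp_module Y)" "bij f"
    using assms unfolding module_isomorphic_def by blast
  have f0: "f 0 = 0"
  proof -
    have "f (0 + 0) = f 0 + f 0" using f(1) unfolding module_homs_def by blast
    then show ?thesis by (metis add.right_neutral add_left_cancel)
  qed
  have f1: "f 1 \<noteq> 0"
    using f(2) f0 by (metis bij_pointE zero_neq_one)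
  have eq: "f (supp_char X s) = supp_char Y s * f 1" for s
  proof -
    have "f (supp_module X (Poly_Mapping.single (Additive s) 1) 1) =
        supp_module Y (Poly_Mapping.single (Additive s) 1) (f 1)"
      using f(1) unfolding module_homs_def by blast
    then show ?thesis by (simp add: supp_module_eq char_module_def)
  qed
  have "supp s \<le> X \<longleftrightarrow> supp s \<le> Y" for s
    using eq[of s] f0 f1 by (auto simp: supp_char_def split: if_splits)
  then show ?thesis
    by (metis order.refl order.antisym supp_surj)
qed

lemma submodule_semigroup_algebraI:
  fixes act :: "('s::monoid_mult, 'k::field) semigroup_algebra \<Rightarrow> 'v::ab_group_add \<Rightarrow> 'v"
  assumes "left_module act" "0 \<in> W" "\<And>v w. \<lbrakk>v \<in> W; w \<in> W\<rbrakk> \<Longrightarrow> v + w \<in> W"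
    and "\<And>s c w. w \<in> W \<Longrightarrow> act (Poly_Mapping.single (Additive s) c) w \<in> W"
  shows "submodule act W"
proof -
  interpret left_module act by fact
  have "act a w \<in> W" if "w \<in> W" for a w
  proof (induction a rule: poly_mapping_single_add_induct)
    case (single s c)
    show ?case using assms(4)[OF that, of "of_additive s" c] by simp
  qed (simp_all add: assms(2,3) scale_left_distrib)
  then show ?thesis using assms(2,3) by (simp add: submodule_def)
qed

text \<open>When every algebra element acts by a scalar, the line through a nonzero vector is a
  submodule, hence everything by simplicity; the isomorphism is the inverse of
  \<open>g\<close>.\<close>

lemma simple_module_char_module:
  fixes act :: "('s::monoid_mult, 'k::field) semigroup_algebra \<Rightarrow> 'v::ab_group_add \<Rightarrow> 'v"
  assumes simple: "simple_module act"
    and act: "\<And>a v. act a v = act (algebra_const (linear_ext \<chi> a)) v"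
  shows "module_isomorphic act (char_module \<chi>)"
proof -
  interpret left_module act
    using simple by (simp add: simple_module_def)
  obtain v0 :: 'v where v0: "v0 \<noteq> 0"
    using simple by (auto simp: simple_module_def)
  define g where "g c = act (algebra_const c) v0" for c
  have g_add: "g b + g c = g (b + c)" for b c
    by (simp add: g_def algebra_const_add scale_left_distrib)
  have g_scale: "act a (g c) = g (linear_ext \<chi> a * c)" for a c
    by (subst act) (simp add: g_def scale_scale algebra_const_mult)
  have g_eq_0: "c = 0" if "g c = 0" for c
  proof (rule ccontr)
    assume "c \<noteq> 0"
    have "act (algebra_const (1 / c)) (g c) = v0"
      using \<open>c \<noteq> 0\<close> by (simp add: g_def scale_scale algebra_const_mult[symmetric] scale_one)
    then show False using that v0 by simp
  qed
  have "inj g"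
  proof (rule injI)
    fix b c assume "g b = g c"
    then have "g (b - c) = 0"
      using g_add[of "b - c" c] by simp
    then show "b = c" using g_eq_0 by fastforce
  qed
  moreover have "surj g"
  proof -
    have "submodule act (range g)"
      unfolding submodule_def
    proof (intro conjI ballI allI)
      have "g 0 = 0" by (simp add: g_def)
      then show "0 \<in> range g" by (metis rangeI)
    qed (auto simp: g_add g_scale)
    moreover have "g 1 = v0"
      by (simp add: g_def scale_one)
    then have "range g \<noteq> {0}"
      using v0 by (metis rangeI singletonD)
    ultimately show ?thesis
      using simple by (auto simp: simple_module_def)
  qed
  ultimately have g: "bij g" by (rule bijI)
  have inv_g: "inv g (g c) = c" for c
    using g by (simp add: bij_is_inj inv_f_f)
  have surj: "\<exists>c. v = g c" for v
    using g by (metis bij_pointE)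
  have "inv g \<in> module_homs UNIV act (char_module \<chi>)"
    unfolding module_homs_def
  proof (intro CollectI conjI ballI allI impI)
    show "inv g (v + w) = inv g v + inv g w" for v w
      using surj[of v] surj[of w] by (auto simp: g_add inv_g)
    show "inv g (act a v) = char_module \<chi> a (inv g v)" for a v
      using surj[of v] by (auto simp: g_scale inv_g char_module_def)
  qed simp
  then show ?thesis
    using bij_imp_bij_inv[OF g] unfolding module_isomorphic_def by blast
qed

lemma simple_module_isomorphic_supp_module:
  fixes act :: "('s::{finite,left_regular_band_1}, 'k::field) semigroup_algebra
    \<Rightarrow> 'v::ab_group_add \<Rightarrow> 'v"
  assumes simple: "simple_module act"
  shows "\<exists>X. module_isomorphic act (supp_module X)"
proof -
  interpret left_module act
    using simple by (simp add: simple_module_def)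
  have trivial: "W = {0} \<or> W = UNIV" if "submodule act W" for W
    using simple that by (simp add: simple_module_def)
  define \<sigma> where "\<sigma> s = act (Poly_Mapping.single (Additive s) 1)" for s
  have \<sigma>_add: "\<sigma> s (v + w) = \<sigma> s v + \<sigma> s w" and \<sigma>_0: "\<sigma> s 0 = 0" for s v w
    by (simp_all add: \<sigma>_def scale_right_distrib)
  have \<sigma>_act: "\<sigma> s (act (Poly_Mapping.single (Additive t) c) v) =
      act (algebra_const c) (\<sigma> (s * t) v)" for s t c v
    by (simp add: \<sigma>_def scale_scale algebra_const_def mult_single plus_additive_def
        zero_additive_def)
  have act_single: "act (Poly_Mapping.single (Additive t) c) v = act (algebra_const c) (\<sigma> t v)"
    for t c v
    by (simp add: \<sigma>_def scale_scale algebra_const_def mult_single plus_additive_def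
        zero_additive_def)
  have \<sigma>_\<sigma>: "\<sigma> s (\<sigma> t v) = \<sigma> (s * t) v" for s t v
    by (simp add: \<sigma>_def scale_scale mult_single plus_additive_def)
  have \<sigma>_1: "\<sigma> 1 v = v" for v
    using scale_one[of v] by (simp add: \<sigma>_def zero_additive_def[symmetric])

  \<comment> \<open>The supports of the elements acting nontrivially. The identity acts
    nontrivially, so \<open>A\<close> is nonempty, and finiteness provides a maximal
    \<open>X\<close>.\<close>
  define A where "A = supp ` {s. \<exists>v. \<sigma> s v \<noteq> 0}"
  have "A \<noteq> {}"
  proof -
    obtain v0 :: 'v where "v0 \<noteq> 0"
      using simple by (auto simp: simple_module_def)
    then have "\<sigma> 1 v0 \<noteq> 0" by (simp add: \<sigma>_1)
    then show ?thesis by (auto simp: A_def)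
  qed
  moreover have "finite A" by (simp add: A_def)
  ultimately obtain X where "X \<in> A" and max: "\<And>Z. \<lbrakk>Z \<in> A; X \<le> Z\<rbrakk> \<Longrightarrow> X = Z"
    using finite_has_maximal[of A] by metis
  then obtain s v1 where s: "supp s = X" and v1: "\<sigma> s v1 \<noteq> 0"
    by (auto simp: A_def)

  have zero: "\<sigma> t v = 0" if "\<not> supp t \<le> X" for t v
  proof -
    define W where "W = {w. \<forall>t. \<not> supp t \<le> X \<longrightarrow> \<sigma> t w = 0}"
    have "submodule act W"
      by (rule submodule_semigroup_algebraI[OF left_module_axioms])
        (auto simp: W_def \<sigma>_0 \<sigma>_add \<sigma>_act supp_mult_le_iff)
    then have "W = {0} \<or> W = UNIV" by (rule trivial)
    \<comment> \<open>If \<open>t\<close> did not kill this vector, \<open>t * s\<close> would act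
      nontrivially with support above \<open>X\<close>. By maximality that support is
      \<open>X\<close>, so \<open>supp t\<close> lies below \<open>X\<close>.\<close>
    moreover have "\<sigma> s v1 \<in> W"
      unfolding W_def
    proof (intro CollectI allI impI, rule ccontr)
      fix t assume t: "\<not> supp t \<le> X" and "\<sigma> t (\<sigma> s v1) \<noteq> 0"
      then have "supp (t * s) \<in> A" by (auto simp: A_def \<sigma>_\<sigma>)
      moreover have "X \<le> supp (t * s)"
        using s supp_mult_le_iff[of t s "supp (t * s)"] by simp
      ultimately have "X = supp (t * s)" by (rule max)
      then show False
        using t supp_mult_le_iff[of t s X] by simp
    qed
    ultimately have "v \<in> W" using v1 by auto
    then show ?thesis using that by (simp add: W_def)
  qed
  have one: "\<sigma> t v = v" if "supp t \<le> X" for t v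
  proof -
    \<comment> \<open>The kernel of \<open>s\<close> is stable: \<open>s t = s\<close> when
      \<open>supp t\<close> lies below \<open>X\<close>, and otherwise \<open>t\<close> acts as 0.
      It misses \<open>v1\<close>, so it is zero, yet it contains
      \<open>\<sigma> t v - v\<close>.\<close>
    define W where "W = {w. \<sigma> s w = 0}"
    have "submodule act W"
    proof (rule submodule_semigroup_algebraI[OF left_module_axioms])
      fix t c w assume w: "w \<in> W"
      show "act (Poly_Mapping.single (Additive t) c) w \<in> W"
      proof (cases "supp t \<le> X")
        case True
        then have "s * t = s" using s by (simp add: supp_le_iff[symmetric])
        with w show ?thesis by (simp add: W_def \<sigma>_act)
      next
        case False
        then show ?thesis by (simp add: W_def act_single zero \<sigma>_0)
      qed
    qed (simp_all add: W_def \<sigma>_0 \<sigma>_add)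
    then have "W = {0} \<or> W = UNIV" by (rule trivial)
    moreover have "v1 \<notin> W" using v1 by (simp add: W_def)
    moreover have "\<sigma> t v - v \<in> W"
    proof -
      have "s * t = s" using that s by (simp add: supp_le_iff[symmetric])
      then have "\<sigma> s (\<sigma> t v) = \<sigma> s v" by (simp add: \<sigma>_\<sigma>)
      then show ?thesis
        using \<sigma>_add[of s "\<sigma> t v - v" v] by (simp add: W_def)
    qed
    ultimately have "\<sigma> t v - v = 0" by auto
    then show ?thesis by simp
  qed
  have "act a v = act (algebra_const (linear_ext (supp_char X) a)) v" for a v
  proof (induction a rule: poly_mapping_single_add_induct)
    case (single t c)
    then show ?case
      using act_single[of "of_additive t" c v]
      by (simp add: supp_char_def zero one)
  qed (simp_all add: scale_left_distrib linear_ext_add algebra_const_add)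
  then have "module_isomorphic act (char_module (supp_char X))"
    by (rule simple_module_char_module[OF simple])
  then show ?thesis
    by (auto simp: supp_module_eq)
qed

text \<open>The first three conjuncts identify the simple modules with the elements of
  \<open>L\<close>; the last counts the arrows for an arbitrary representative \<open>y\<close>.
  Arrows from \<open>X\<close> to \<open>Y\<close> come from Ext of M_X by M_Y, so M_X is resolved:
  \<psi> is the character of \<open>X\<close> and \<phi> that of \<open>Y\<close>.\<close>

theorem theorem6p2:
  shows "(\<forall>X :: 's::{finite,left_regular_band_1} support.
       simple_module (supp_module X :: ('s, 'k::field) semigroup_algebra \<Rightarrow> 'k \<Rightarrow> 'k)) \<and>
    (\<forall>X Y :: 's support.
       module_isomorphic (supp_module X :: ('s, 'k) semigroup_algebra \<Rightarrow> 'k \<Rightarrow> 'k)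
         (supp_module Y :: ('s, 'k) semigroup_algebra \<Rightarrow> 'k \<Rightarrow> 'k) \<longrightarrow> X = Y) \<and>
    (\<forall>act :: ('s, 'k) semigroup_algebra \<Rightarrow> 'v::ab_group_add \<Rightarrow> 'v.
       simple_module act \<longrightarrow>
       (\<exists>X :: 's support. module_isomorphic act
          (supp_module X :: ('s, 'k) semigroup_algebra \<Rightarrow> 'k \<Rightarrow> 'k))) \<and>
    (\<forall>(X :: 's support) (Y :: 's support) (y :: 's). supp y = Y \<longrightarrow>
       ext1_has_dim (algebra_const :: 'k \<Rightarrow> ('s, 'k) semigroup_algebra)
         (supp_module X :: ('s, 'k) semigroup_algebra \<Rightarrow> 'k \<Rightarrow> 'k)
         (supp_module Y :: ('s, 'k) semigroup_algebra \<Rightarrow> 'k \<Rightarrow> 'k)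
         (arrow_number y X Y))"
proof (intro conjI allI impI)
  fix X Y :: "'s support" and y :: 's
  assume "supp y = Y"
  then show "ext1_has_dim (algebra_const :: 'k \<Rightarrow> ('s, 'k) semigroup_algebra)
      (supp_module X) (supp_module Y) (arrow_number y X Y)"
    unfolding supp_module_eq
    by (intro ext1_char_module_dim is_char_supp_char arrow_number_dim)
qed (rule simple_supp_module, erule supp_module_isomorphic_imp_eq,
    erule simple_module_isomorphic_supp_module)

end
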